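(* There exist a Fréchet space $X$, a continuous linear operator $T:X\to X$ and a sequence of nonzero scalars $(\lambda_n)_n$ such that $\frac{\lambda_{n+1}}{\lambda_n}\to 1$ and $(\lambda_nT^n)_n$ has property $\mathcal{P}_{\mathcal{AP}}$, but $T$ is not multiply recurrent.
   Context: $\mathcal{AP}$ is the family of all subsets of $\mathbb{N}$ that contain arbitrarily long (finite) arithmetic progressions $\{a,a+k,\dots,a+mk\}$ (common difference $k\ge 1$). A sequence of operators $(T_n)_n$ on $X$ has property $\mathcal{P}_{\mathcal{AP}}$ if for each nonempty open set $U\subseteq X$ there exists $x\in X$ such that $\{n\in\mathbb{N}: T_n x\in U\}\in\mathcal{AP}$. $T$ is multiply recurrent if for every nonempty open set $U$ and every $m\in\mathbb{N}$ there is $k\ge 1$ such that $U\cap T^{-k}(U)\cap\dots\cap T^{-km}(U)\neq\emptyset$. *)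

theory Defs
  imports "HOL-Analysis.Analysis" "HOL-Library.Function_Algebras"
begin

text \<open>The scalar field is a type of class \<^class>\<open>real_normed_field\<close>; up to isomorphism (Gelfand--Mazur)
  the only such fields are the reals and the complex numbers.  Spaces are given as a carrier set
  \<open>X\<close> inside an ambient type of vectors, with a topology \<open>\<tau>\<close> on that carrier.\<close>

definition seminorm_on ::
  "('k::real_normed_field \<Rightarrow> 'v::ab_group_add \<Rightarrow> 'v) \<Rightarrow> 'v set \<Rightarrow> ('v \<Rightarrow> real) \<Rightarrow> bool" where
  "seminorm_on smul X p \<longleftrightarrow>
     (\<forall>x\<in>X. 0 \<le> p x) \<and>
     (\<forall>x\<in>X. \<forall>y\<in>X. p (x + y) \<le> p x + p y) \<and>
     (\<forall>c. \<forall>x\<in>X. p (smul c x) = norm c * p x)"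

text \<open>The locale \<^locale>\<open>Metric_space\<close> asks for nonnegativity and symmetry on the whole type,
  hence the value 0 outside the carrier.\<close>

definition frechet_dist :: "'v set \<Rightarrow> (nat \<Rightarrow> 'v::ab_group_add \<Rightarrow> real) \<Rightarrow> 'v \<Rightarrow> 'v \<Rightarrow> real" where
  "frechet_dist X p x y =
     (if x \<in> X \<and> y \<in> X then \<Sum>n. (1 / 2) ^ n * min 1 (p n (x - y)) else 0)"

definition frechet_space ::
  "('k::real_normed_field \<Rightarrow> 'v::ab_group_add \<Rightarrow> 'v) \<Rightarrow> 'v set \<Rightarrow> 'v topology \<Rightarrow> bool" where
  "frechet_space smul X \<tau> \<longleftrightarrow>
     vector_space smul \<and> module.subspace smul X \<and>
     (\<exists>p. (\<forall>n. seminorm_on smul X (p n)) \<and>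
          (\<forall>x\<in>X. (\<forall>n. p n x = 0) \<longrightarrow> x = 0) \<and>
          Metric_space.mcomplete X (frechet_dist X p) \<and>
          \<tau> = Metric_space.mtopology X (frechet_dist X p))"

text \<open>The constants of \<^locale>\<open>Metric_space\<close> used above are meaningful, because \<^const>\<open>frechet_dist\<close>
  is a metric on \<open>X\<close>.\<close>

lemma Metric_space_frechet_dist:
  fixes smul :: "'k::real_normed_field \<Rightarrow> 'v::ab_group_add \<Rightarrow> 'v"
  assumes vs: "vector_space smul" and sub: "module.subspace smul X"
    and p: "\<And>n. seminorm_on smul X (p n)"
    and sep: "\<And>x. x \<in> X \<Longrightarrow> (\<And>n. p n x = 0) \<Longrightarrow> x = 0"
  shows "Metric_space X (frechet_dist X p)"
proof -
  interpret vector_space smul by (rule vs)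
  have diff: "x - y \<in> X" if "x \<in> X" "y \<in> X" for x y
    using sub that by (rule subspace_diff)
  have nonneg: "0 \<le> p n x" if "x \<in> X" for n x
    using p[of n] that by (simp add: seminorm_on_def)
  have sym: "p n (x - y) = p n (y - x)" if "x \<in> X" "y \<in> X" for n x y
  proof -
    have "p n (smul (- 1) (y - x)) = norm (- 1 :: 'k) * p n (y - x)"
      using p[of n] diff[OF that(2) that(1)] unfolding seminorm_on_def by blast
    then show ?thesis by simp
  qed
  have tri: "p n (x - z) \<le> p n (x - y) + p n (y - z)" if "x \<in> X" "y \<in> X" "z \<in> X" for n x y z
  proof -
    have "p n ((x - y) + (y - z)) \<le> p n (x - y) + p n (y - z)"
      using p[of n] diff[OF that(1,2)] diff[OF that(2,3)] unfolding seminorm_on_def by blast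
    then show ?thesis by simp
  qed
  have summ: "summable (\<lambda>n. (1 / 2) ^ n * min 1 (p n (x - y)))" if "x \<in> X" "y \<in> X" for x y
  proof (rule summable_comparison_test')
    show "summable (\<lambda>n. (1 / 2 :: real) ^ n)" by (simp add: summable_geometric)
    show "norm ((1 / 2) ^ n * min 1 (p n (x - y))) \<le> (1 / 2) ^ n" if "n \<ge> 0" for n
      using nonneg[OF diff[OF \<open>x \<in> X\<close> \<open>y \<in> X\<close>], of n] by (simp add: abs_mult mult_left_le)
  qed
  have zero: "p n 0 = 0" for n
  proof -
    have "0 \<in> X" using sub by (rule subspace_0)
    then have "p n (smul 0 0) = norm (0 :: 'k) * p n 0"
      using p[of n] unfolding seminorm_on_def by blast
    then show ?thesis by simp
  qed
  have term_nonneg: "0 \<le> (1 / 2) ^ n * min 1 (p n (x - y))" if "x \<in> X" "y \<in> X" for n x y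
    using nonneg[OF diff[OF that]] by simp
  show ?thesis
  proof
    show "0 \<le> frechet_dist X p x y" for x y
      unfolding frechet_dist_def using suminf_nonneg[OF summ term_nonneg] by auto
    show "frechet_dist X p x y = frechet_dist X p y x" for x y
      unfolding frechet_dist_def using sym[of x y] by auto
    show "frechet_dist X p x y = 0 \<longleftrightarrow> x = y" if xy: "x \<in> X" "y \<in> X" for x y
    proof
      assume "frechet_dist X p x y = 0"
      then have "\<forall>n. (1 / 2) ^ n * min 1 (p n (x - y)) = 0"
        unfolding frechet_dist_def if_P[OF conjI[OF xy]]
        by (subst (asm) suminf_eq_zero_iff[OF summ[OF xy] term_nonneg[OF xy]])
      then have "min 1 (p n (x - y)) = 0" for n by simp
      then have "p n (x - y) = 0" for n
        by (metis min_def zero_neq_one)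
      then show "x = y" using sep[OF diff[OF xy]] by simp
    qed (simp add: frechet_dist_def zero)
    show "frechet_dist X p x z \<le> frechet_dist X p x y + frechet_dist X p y z"
      if x: "x \<in> X" and y: "y \<in> X" and z: "z \<in> X" for x y z
    proof -
      have "(\<Sum>n. (1 / 2) ^ n * min 1 (p n (x - z)))
          \<le> (\<Sum>n. (1 / 2) ^ n * min 1 (p n (x - y)) + (1 / 2) ^ n * min 1 (p n (y - z)))"
      proof (rule suminf_le[OF _ summ[OF x z] summable_add[OF summ[OF x y] summ[OF y z]]])
        fix n
        have "min 1 (p n (x - z)) \<le> min 1 (p n (x - y)) + min 1 (p n (y - z))"
          using tri[OF x y z, of n] nonneg[OF diff[OF x y], of n] nonneg[OF diff[OF y z], of n]
          by linarith
        then have "(1 / 2) ^ n * min 1 (p n (x - z))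
            \<le> (1 / 2) ^ n * (min 1 (p n (x - y)) + min 1 (p n (y - z)))"
          by (intro mult_left_mono) auto
        then show "(1 / 2) ^ n * min 1 (p n (x - z))
            \<le> (1 / 2) ^ n * min 1 (p n (x - y)) + (1 / 2) ^ n * min 1 (p n (y - z))"
          by (simp add: distrib_left)
      qed
      also have "\<dots> = (\<Sum>n. (1 / 2) ^ n * min 1 (p n (x - y)))
          + (\<Sum>n. (1 / 2) ^ n * min 1 (p n (y - z)))"
        by (rule suminf_add[OF summ[OF x y] summ[OF y z], symmetric])
      finally show ?thesis by (simp add: frechet_dist_def x y z)
    qed
  qed
qed

definition linear_operator_on ::
  "('k::real_normed_field \<Rightarrow> 'v::ab_group_add \<Rightarrow> 'v) \<Rightarrow> 'v set \<Rightarrow> ('v \<Rightarrow> 'v) \<Rightarrow> bool" where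
  "linear_operator_on smul X T \<longleftrightarrow>
     T ` X \<subseteq> X \<and>
     (\<forall>x\<in>X. \<forall>y\<in>X. T (x + y) = T x + T y) \<and>
     (\<forall>c. \<forall>x\<in>X. T (smul c x) = smul c (T x))"

definition AP_family :: "nat set set" where
  "AP_family = {A. \<forall>m. \<exists>a k. k \<ge> 1 \<and> (\<forall>j\<le>m. a + j * k \<in> A)}"

definition has_property_P :: "nat set set \<Rightarrow> 'v topology \<Rightarrow> (nat \<Rightarrow> 'v \<Rightarrow> 'v) \<Rightarrow> bool" where
  "has_property_P \<F> \<tau> Ts \<longleftrightarrow>
     (\<forall>U. openin \<tau> U \<and> U \<noteq> {} \<longrightarrow> (\<exists>x\<in>topspace \<tau>. {n. Ts n x \<in> U} \<in> \<F>))"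

definition multiply_recurrent :: "'v topology \<Rightarrow> ('v \<Rightarrow> 'v) \<Rightarrow> bool" where
  "multiply_recurrent \<tau> T \<longleftrightarrow>
     (\<forall>U. openin \<tau> U \<and> U \<noteq> {} \<longrightarrow>
        (\<forall>m. \<exists>k\<ge>1. (\<Inter>j\<in>{0..m}. {x \<in> topspace \<tau>. (T ^^ (j * k)) x \<in> U}) \<noteq> {}))"

text \<open>Scalar multiplication of sequences, for spaces realised as linear subspaces of \<open>K\<^sup>\<nat>\<close> carrying a
  topology of their own.  Since \<open>K\<^sup>\<nat>\<close> has the dimension of the continuum, every Frechet space with at
  most continuum many elements, in particular every separable one, is of this form up to linear
  homeomorphism.\<close>

definition seq_smul :: "'k::real_normed_field \<Rightarrow> (nat \<Rightarrow> 'k) \<Rightarrow> nat \<Rightarrow> 'k" where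
  "seq_smul c x = (\<lambda>i. c * x i)"

lemma vector_space_seq_smul: "vector_space (seq_smul :: 'k::real_normed_field \<Rightarrow> _)"
  by unfold_locales (auto simp: seq_smul_def fun_eq_iff algebra_simps)

end

theory Submission
  imports Defs "HOL-Real_Asymp.Real_Asymp"
begin

text \<open>
  The space is \<open>c\<^sub>0\<close> with the supremum norm, the operator is the unweighted backward shift \<open>B\<close>,
  and the scalars are \<open>\<lambda>\<^sub>n = exp (sqrt n)\<close>.

  The shift is not even recurrent: if \<open>x\<close> and \<open>B\<^sup>k x\<close> with \<open>k \<ge> 1\<close> both lie close to the first unit
  vector, then the entry \<open>x k\<close> is close to 0 because of \<open>x\<close> and close to 1 because of \<open>B\<^sup>k x\<close>.

  The scalars grow so slowly that their consecutive ratios tend to 1, but they still grow: if the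
  square roots of the elements of a set \<open>D\<close> of times are far apart, then \<open>\<lambda>\<^sub>n / \<lambda>\<^sub>n\<^sub>'\<close> is tiny for
  \<open>n < n'\<close> in \<open>D\<close>.  To visit the vicinity of a given \<open>u\<close> at all times in \<open>D\<close>, write a copy of the
  initial segment of \<open>u\<close>, divided by \<open>\<lambda>\<^sub>n\<close>, into the coordinates from each \<open>n \<in> D\<close> on.  At time
  \<open>n\<close> the copy belonging to \<open>n\<close> is restored exactly, the earlier copies have been shifted away, and
  the later copies carry the tiny factor \<open>\<lambda>\<^sub>n / \<lambda>\<^sub>n\<^sub>'\<close> (lemma \<open>approximate_visits\<close>).  There are such
  sets \<open>D\<close> with arbitrarily long progressions: a progression of length \<open>r\<close> and difference \<open>r\<close> that
  starts at \<open>r\<^sup>2\<close> has square roots at mutual distance at least \<open>1 / 4\<close>; take such blocks for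
  \<open>r = 2\<^sup>m\<close>, and enlarge all distances by a dilation (lemmas \<open>spread_times_sqrt_gap\<close> and
  \<open>approximate_AP_visits\<close>).

  The space \<open>c\<^sub>0\<close> over \<open>'k\<close> is complete only if \<open>'k\<close> is.  Completeness is not part of the class
  \<^class>\<open>real_normed_field\<close>, but it follows from the theorem of Gelfand, Mazur and Ostrowski that every
  element of \<open>'k\<close> is a root of a real polynomial of degree at most 2 (\<open>exists_quad_form_zero\<close>), so that
  \<open>'k\<close> is spanned over the reals by two elements (\<open>real_normed_field_complete\<close>).
\<close>

section \<open>Completeness of real normed fields\<close>

text \<open>This is \<open>(b - c) (b - cnj c)\<close>, written so that it makes sense in a field without an imaginary
  unit.\<close>

definition quad_form :: "'k::real_normed_field \<Rightarrow> complex \<Rightarrow> 'k" where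
  "quad_form b c = (b - of_real (Re c))\<^sup>2 + of_real ((Im c)\<^sup>2)"

lemma quad_form_square:
  "quad_form (b\<^sup>2) (c\<^sup>2) = quad_form b c * quad_form b (- c)"
proof -
  have "Re (c\<^sup>2) = (Re c)\<^sup>2 - (Im c)\<^sup>2" "Im (c\<^sup>2) = 2 * Re c * Im c"
    by (simp_all add: power2_eq_square)
  then show ?thesis
    by (simp add: quad_form_def power2_eq_square algebra_simps)
qed

lemma quad_form_add_of_real: "quad_form (b + of_real r) c = quad_form b (c - of_real r)"
  by (simp add: quad_form_def algebra_simps)

text \<open>Every complex number has a square root, so \<open>quad_form_square\<close> turns the values of the form at
  \<open>b\<^sup>2\<close> into products of two of its values at \<open>b\<close>.\<close>

lemma quad_form_lower_bound_square:
  assumes "\<And>c. m \<le> norm (quad_form b c)" "0 \<le> m"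
  shows "m\<^sup>2 \<le> norm (quad_form (b\<^sup>2 + of_real r) c)"
proof -
  define d where "d = csqrt (c - of_real r)"
  have "quad_form (b\<^sup>2 + of_real r) c = quad_form b d * quad_form b (- d)"
    by (simp add: quad_form_add_of_real d_def flip: quad_form_square)
  then show ?thesis
    using assms by (simp add: norm_mult power2_eq_square mult_mono)
qed

text \<open>This is the heart of Ostrowski's argument: a positive minimum \<open>m\<close> of the form propagates.  Let
  \<open>h = b\<^sup>2 + t\<close> and \<open>s = - m / 2\<close>.  Repeated squaring keeps the lower bounds, so every factor of
  \<open>h\<^sup>n - s\<^sup>n = (h - s) (h + s) (h\<^sup>2 + s\<^sup>2) \<dots>\<close>, with \<open>n\<close> a power of 2, other than \<open>h - s\<close> is at least the
  corresponding power of \<open>m\<close>.  On the other hand the product is at most \<open>m\<^sup>n + (m / 2)\<^sup>n\<close>, which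
  leaves no room for \<open>h - s\<close> to exceed \<open>m\<close> as \<open>n\<close> grows.\<close>

lemma minimal_quad_form_shift:
  fixes b :: "'k::real_normed_field"
  assumes lb: "\<And>c. m \<le> norm (quad_form b c)" and m: "0 < m"
    and h: "norm (b\<^sup>2 + of_real t) = m"
  shows "norm (b\<^sup>2 + of_real (t + m / 2)) \<le> m"
proof -
  define h where "h = b\<^sup>2 + of_real t"
  define s :: 'k where "s = - of_real (m / 2)"
  have lbh: "(m ^ 2 ^ j)\<^sup>2 \<le> norm (quad_form (h ^ 2 ^ j) c)" for j c
  proof (induction j arbitrary: c)
    case 0
    show ?case
      unfolding h_def using quad_form_lower_bound_square[OF lb] m by simp
  next
    case (Suc j)
    have "((m ^ 2 ^ j)\<^sup>2)\<^sup>2 \<le> norm (quad_form ((h ^ 2 ^ j)\<^sup>2 + of_real 0) c)"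
      by (rule quad_form_lower_bound_square[OF Suc]) simp
    then show ?case by (simp add: mult.commute flip: power_mult)
  qed
  \<comment> \<open>At a real point the form is a square, so its lower bound is one for the distance to that point.\<close>
  have dist: "m ^ 2 ^ j \<le> norm (h ^ 2 ^ j + s ^ 2 ^ j)" for j
  proof -
    define c where "c = - ((- m / 2) ^ 2 ^ j)"
    have "s ^ 2 ^ j = - of_real c" unfolding s_def c_def
      by (simp only: of_real_minus[symmetric] of_real_power[symmetric] minus_minus minus_divide_left)
    moreover have "(m ^ 2 ^ j)\<^sup>2 \<le> (norm (h ^ 2 ^ j - of_real c))\<^sup>2"
      using lbh[of j "of_real c"] by (simp add: quad_form_def norm_power)
    ultimately show ?thesis using power2_le_imp_le[of "m ^ 2 ^ j" "norm (h ^ 2 ^ j - of_real c)"]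
      by simp
  qed
  have lower: "norm (h - s) * m ^ 2 ^ k \<le> m * norm (h ^ 2 ^ k - s ^ 2 ^ k)" for k
  proof (induction k)
    case (Suc k)
    have "norm (h - s) * m ^ 2 ^ Suc k = (norm (h - s) * m ^ 2 ^ k) * m ^ 2 ^ k"
      by (simp add: mult_2 power_add)
    also have "\<dots> \<le> (m * norm (h ^ 2 ^ k - s ^ 2 ^ k)) * norm (h ^ 2 ^ k + s ^ 2 ^ k)"
      by (rule mult_mono[OF Suc dist]) (use m in auto)
    also have "\<dots> = m * norm ((h ^ 2 ^ k - s ^ 2 ^ k) * (h ^ 2 ^ k + s ^ 2 ^ k))"
      by (simp add: norm_mult)
    also have "(h ^ 2 ^ k - s ^ 2 ^ k) * (h ^ 2 ^ k + s ^ 2 ^ k) = h ^ 2 ^ Suc k - s ^ 2 ^ Suc k"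
      by (simp add: algebra_simps mult_2 power_add)
    finally show ?case .
  qed simp
  have upper: "norm (h - s) \<le> m * (1 + (1 / 2) ^ 2 ^ k)" for k
  proof -
    have "norm (h ^ 2 ^ k - s ^ 2 ^ k) \<le> norm h ^ 2 ^ k + norm s ^ 2 ^ k"
      using norm_triangle_ineq4[of "h ^ 2 ^ k" "s ^ 2 ^ k"] by (simp only: norm_power)
    also have "\<dots> = m ^ 2 ^ k * (1 + (1 / 2) ^ 2 ^ k)"
      using h m by (simp add: h_def s_def norm_divide algebra_simps power_divide)
    finally have "m * norm (h ^ 2 ^ k - s ^ 2 ^ k) \<le> m * (m ^ 2 ^ k * (1 + (1 / 2) ^ 2 ^ k))"
      using m by simp
    with lower[of k] have "norm (h - s) * m ^ 2 ^ k \<le> (m * (1 + (1 / 2) ^ 2 ^ k)) * m ^ 2 ^ k"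
      by (simp add: algebra_simps)
    then show ?thesis using m by simp
  qed
  have "(\<lambda>k. m * (1 + (1 / 2) ^ 2 ^ k)) \<longlonglongrightarrow> m" by real_asymp
  then have "norm (h - s) \<le> m"
    by (rule LIMSEQ_le_const) (use upper in blast)
  then show ?thesis by (simp add: h_def s_def algebra_simps)
qed

text \<open>The norm of the form attains its minimum \<open>m\<close>, because it is large far away from the origin.  If
  \<open>m\<close> were positive, then \<open>minimal_quad_form_shift\<close> could be iterated, and the norm would stay equal
  to \<open>m\<close> along arithmetically growing shifts of \<open>b\<^sup>2\<close>.\<close>

theorem exists_quad_form_zero:
  fixes a :: "'k::real_normed_field"
  shows "\<exists>c. quad_form a c = 0"
proof -
  define F where "F c = norm (quad_form a c)" for c
  define K where "K = cball (0::complex) (1 + 4 * norm a)"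
  have grow: "F 0 \<le> F c" if "c \<notin> K" for c
  proof -
    define r where "r = cmod c"
    have r: "1 + 4 * norm a < r" using that by (simp add: K_def r_def)
    have "of_real (r\<^sup>2) = quad_form a c - a\<^sup>2 + of_real (2 * Re c) * a"
      unfolding r_def cmod_power2 by (simp add: quad_form_def power2_eq_square algebra_simps)
    then have "norm (of_real (r\<^sup>2) :: 'k)
        \<le> norm (quad_form a c - a\<^sup>2) + norm (of_real (2 * Re c) * a)"
      by (simp only: norm_triangle_ineq)
    also have "norm (quad_form a c - a\<^sup>2) \<le> norm (quad_form a c) + norm (a\<^sup>2)"
      by (rule norm_triangle_ineq4)
    finally have "norm (of_real (r\<^sup>2) :: 'k)
        \<le> norm (quad_form a c) + norm (a\<^sup>2) + norm (of_real (2 * Re c) * a)" by simp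
    then have "r\<^sup>2 \<le> F c + (norm a)\<^sup>2 + 2 * \<bar>Re c\<bar> * norm a"
      by (simp add: F_def norm_power norm_mult)
    also have "2 * \<bar>Re c\<bar> * norm a \<le> 2 * r * norm a"
      by (simp add: r_def abs_Re_le_cmod mult_right_mono)
    finally have 1: "r\<^sup>2 - (norm a)\<^sup>2 - 2 * r * norm a \<le> F c" by simp
    have "4 * norm a * norm a \<le> r * norm a" using r by (intro mult_right_mono) auto
    moreover have "r * (4 * norm a) \<le> r * r" using r by (intro mult_left_mono) (auto simp: r_def)
    moreover have "0 \<le> norm a * norm a" by simp
    ultimately have "(norm a)\<^sup>2 \<le> r\<^sup>2 - (norm a)\<^sup>2 - 2 * r * norm a"
      unfolding power2_eq_square by linarith
    with 1 show ?thesis by (simp add: F_def quad_form_def norm_power)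
  qed
  have "continuous_on K F" unfolding F_def quad_form_def by (intro continuous_intros)
  moreover have "compact K" by (simp add: K_def)
  moreover have "0 \<in> K" by (simp add: K_def)
  then have "K \<noteq> {}" by blast
  ultimately obtain c0 where c0: "c0 \<in> K" "\<And>c. c \<in> K \<Longrightarrow> F c0 \<le> F c"
    using continuous_attains_inf[of K F] by blast
  have minF: "F c0 \<le> F c" for c
    using c0(2)[of c] c0(2)[OF \<open>0 \<in> K\<close>] grow[of c] by (cases "c \<in> K") auto
  define m where "m = F c0"
  define b where "b = a - of_real (Re c0)"
  have "m = 0"
  proof (rule ccontr)
    assume "m \<noteq> 0"
    then have m: "0 < m" by (simp add: m_def F_def)
    have qb: "quad_form b c = quad_form a (c + of_real (Re c0))" for c
      using quad_form_add_of_real[of b "Re c0" "c + of_real (Re c0)"] by (simp add: b_def)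
    have lb: "m \<le> norm (quad_form b c)" for c
      using minF[of "c + of_real (Re c0)"] by (simp add: qb m_def F_def)
    define t where "t k = (Im c0)\<^sup>2 + real k * (m / 2)" for k
    have "norm (b\<^sup>2 + of_real (t k)) = m" for k
    proof (induction k)
      case 0
      show ?case by (simp add: t_def m_def F_def quad_form_def b_def)
    next
      case (Suc k)
      have t: "t (Suc k) = t k + m / 2" by (simp add: t_def algebra_simps)
      have "norm (b\<^sup>2 + of_real (t (Suc k))) \<le> m"
        unfolding t by (rule minimal_quad_form_shift[OF lb m Suc])
      moreover have "0 \<le> t (Suc k)" using m by (simp add: t_def)
      then have "m \<le> norm (b\<^sup>2 + of_real (t (Suc k)))"
        using lb[of "Complex 0 (sqrt (t (Suc k)))"] by (simp add: quad_form_def)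
      ultimately show ?case by simp
    qed
    note nt = this
    \<comment> \<open>Five shifts by \<open>m / 2\<close> are further than the diameter \<open>2 * m\<close> of a ball of radius \<open>m\<close>.\<close>
    have "of_real (5 * (m / 2)) = (b\<^sup>2 + of_real (t 5)) - (b\<^sup>2 + of_real (t 0))"
      by (simp add: t_def)
    then have "norm (of_real (5 * (m / 2)) :: 'k) \<le> m + m"
      using norm_triangle_ineq4[of "b\<^sup>2 + of_real (t 5)" "b\<^sup>2 + of_real (t 0)"] nt by metis
    with m show False by simp
  qed
  then show ?thesis by (auto simp: m_def F_def)
qed

text \<open>Here \<open>w\<close> is an imaginary unit if there is one.  If there is none, completing the square shows that
  the roots found above are real, and \<open>w = 0\<close> serves.  The bound on the coordinates comes from
  \<open>a * cnj a = x\<^sup>2 + y\<^sup>2\<close>.\<close>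

lemma real_normed_field_coordinates:
  "\<exists>w::'k::real_normed_field. \<forall>a. \<exists>x y. a = of_real x + of_real y * w \<and> \<bar>x\<bar> + \<bar>y\<bar> \<le> 2 * norm a"
proof (cases "\<exists>w::'k. w\<^sup>2 = - 1")
  case True
  then obtain w :: 'k where w: "w\<^sup>2 = - 1" by blast
  have nw: "norm w = 1"
  proof -
    have "(norm w)\<^sup>2 = 1" using arg_cong[OF w, of norm] by (simp add: norm_power)
    then show ?thesis using power2_eq_imp_eq[of "norm w" 1] by simp
  qed
  show ?thesis
  proof (intro exI[of _ w] allI)
    fix a :: 'k
    obtain c where c: "quad_form a c = 0" using exists_quad_form_zero by blast
    then have "(a - of_real (Re c))\<^sup>2 = (of_real (Im c) * w)\<^sup>2"
      by (simp add: quad_form_def power_mult_distrib w eq_neg_iff_add_eq_0)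
    then have "a - of_real (Re c) = of_real (Im c) * w \<or> a - of_real (Re c) = - (of_real (Im c) * w)"
      by (simp add: power2_eq_iff)
    then obtain x y where a: "a = of_real x + of_real y * w"
      by (metis add.commute diff_add_cancel mult_minus_left of_real_minus)
    have prod: "a * (of_real x - of_real y * w) = of_real (x\<^sup>2 + y\<^sup>2)"
    proof -
      have "a * (of_real x - of_real y * w) = of_real (x\<^sup>2) - of_real (y\<^sup>2) * w\<^sup>2"
        unfolding a by (simp add: power2_eq_square algebra_simps)
      then show ?thesis by (simp add: w)
    qed
    have conj_le: "norm (of_real x - of_real y * w) \<le> \<bar>x\<bar> + \<bar>y\<bar>"
      using norm_triangle_ineq4[of "of_real x" "of_real y * w"] by (simp add: norm_mult nw)
    have "norm (of_real (x\<^sup>2 + y\<^sup>2) :: 'k) = x\<^sup>2 + y\<^sup>2" by (simp only: norm_of_real) simp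
    then have "x\<^sup>2 + y\<^sup>2 = norm a * norm (of_real x - of_real y * w)"
      using prod by (metis norm_mult)
    also have "\<dots> \<le> norm a * (\<bar>x\<bar> + \<bar>y\<bar>)" by (intro mult_left_mono conj_le) simp
    finally have "x\<^sup>2 + y\<^sup>2 \<le> norm a * (\<bar>x\<bar> + \<bar>y\<bar>)" .
    moreover have "(\<bar>x\<bar> + \<bar>y\<bar>)\<^sup>2 \<le> 2 * (x\<^sup>2 + y\<^sup>2)"
      using zero_le_power2[of "\<bar>x\<bar> - \<bar>y\<bar>"] by (simp add: power2_eq_square algebra_simps)
    ultimately have "(\<bar>x\<bar> + \<bar>y\<bar>) * (\<bar>x\<bar> + \<bar>y\<bar>) \<le> (2 * norm a) * (\<bar>x\<bar> + \<bar>y\<bar>)"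
      by (simp add: power2_eq_square algebra_simps)
    then have "\<bar>x\<bar> + \<bar>y\<bar> \<le> 2 * norm a" if "0 < \<bar>x\<bar> + \<bar>y\<bar>"
      using that by (rule mult_right_le_imp_le)
    moreover have "0 \<le> 2 * norm a" by simp
    ultimately have "\<bar>x\<bar> + \<bar>y\<bar> \<le> 2 * norm a" by linarith
    with a show "\<exists>x y. a = of_real x + of_real y * w \<and> \<bar>x\<bar> + \<bar>y\<bar> \<le> 2 * norm a" by blast
  qed
next
  case False
  show ?thesis
  proof (intro exI[of _ "0::'k"] allI)
    fix a :: 'k
    obtain c where c: "quad_form a c = 0" using exists_quad_form_zero by blast
    have "Im c = 0"
    proof (rule ccontr)
      assume "Im c \<noteq> 0"
      then have "((a - of_real (Re c)) / of_real (Im c))\<^sup>2 = - 1"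
        using c by (simp add: quad_form_def power_divide field_simps eq_neg_iff_add_eq_0)
      with False show False by blast
    qed
    with c have "a = of_real (Re c) + of_real 0 * 0" by (simp add: quad_form_def)
    moreover have "\<bar>Re c\<bar> + \<bar>0\<bar> \<le> 2 * norm a" using calculation by simp
    ultimately show "\<exists>x y. a = of_real x + of_real y * 0 \<and> \<bar>x\<bar> + \<bar>y\<bar> \<le> 2 * norm a" by blast
  qed
qed

text \<open>By the bound on the coordinates every ball is contained in the continuous image of a closed disc
  of the complex plane, and that image is compact, hence complete.\<close>

theorem real_normed_field_complete:
  fixes f :: "nat \<Rightarrow> 'k::real_normed_field"
  assumes "Cauchy f"
  shows "convergent f"
proof -
  obtain w :: 'k where w: "\<And>a. \<exists>x y. a = of_real x + of_real y * w \<and> \<bar>x\<bar> + \<bar>y\<bar> \<le> 2 * norm a"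
    using real_normed_field_coordinates by metis
  define V where "V z = of_real (Re z) + of_real (Im z) * w" for z
  have "\<exists>z. a = V z \<and> cmod z \<le> 2 * norm a" for a
  proof -
    obtain x y where "a = of_real x + of_real y * w" "\<bar>x\<bar> + \<bar>y\<bar> \<le> 2 * norm a" using w by blast
    then show ?thesis
      using cmod_le[of "Complex x y"] by (intro exI[of _ "Complex x y"]) (auto simp: V_def)
  qed
  then have cover: "a \<in> V ` cball 0 (2 * norm a)" for a by (force simp: V_def)
  obtain r where r: "\<And>n. norm (f n) \<le> r"
    using Cauchy_Bseq[OF assms] by (auto simp: Bseq_def)
  have "continuous_on (cball 0 (2 * r)) V" unfolding V_def by (intro continuous_intros)
  then have "compact (V ` cball 0 (2 * r))" by (rule compact_continuous_image) simp
  then have "complete (V ` cball 0 (2 * r))" by (rule compact_imp_complete)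
  moreover have "f n \<in> V ` cball 0 (2 * r)" for n
    using cover[of "f n"] r[of n] by fastforce
  ultimately show ?thesis using assms unfolding complete_def convergent_def by blast
qed


section \<open>The Banach space of null sequences\<close>

text \<open>The constant sequence of seminorms \<open>p\<close> makes the series for the distance geometric, with sum
  \<open>2 * min 1 (p (x - y))\<close>.\<close>

lemma frechet_space_if_complete_norm:
  fixes smul :: "'k::real_normed_field \<Rightarrow> 'v::ab_group_add \<Rightarrow> 'v"
  assumes vs: "vector_space smul" and sub: "module.subspace smul X"
    and p: "seminorm_on smul X p"
    and sep: "\<And>x. x \<in> X \<Longrightarrow> p x = 0 \<Longrightarrow> x = 0"
    and complete: "\<And>\<sigma>. (\<And>n. \<sigma> n \<in> X) \<Longrightarrow>
        (\<And>e. 0 < e \<Longrightarrow> \<exists>N. \<forall>m\<ge>N. \<forall>n\<ge>N. p (\<sigma> m - \<sigma> n) < e) \<Longrightarrow>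
        \<exists>l\<in>X. (\<lambda>n. p (\<sigma> n - l)) \<longlonglongrightarrow> 0"
  defines "d \<equiv> frechet_dist X (\<lambda>_. p)"
  shows "Metric_space X d"
    and "frechet_space smul X (Metric_space.mtopology X d)"
    and "\<And>x y. x \<in> X \<Longrightarrow> y \<in> X \<Longrightarrow> d x y = 2 * min 1 (p (x - y))"
proof -
  show ms: "Metric_space X d"
    unfolding d_def using vs sub p sep by (intro Metric_space_frechet_dist) auto
  show d_eq: "d x y = 2 * min 1 (p (x - y))" if "x \<in> X" "y \<in> X" for x y
    using that by (simp add: d_def frechet_dist_def suminf_mult2[symmetric] suminf_geometric
        summable_geometric)
  interpret Metric_space X d by (rule ms)
  have "mcomplete"
    unfolding mcomplete_def
  proof (intro allI impI)
    fix \<sigma> assume "MCauchy \<sigma>"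
    then have \<sigma>: "\<sigma> n \<in> X" for n by (auto simp: MCauchy_def)
    have "\<exists>N. \<forall>m\<ge>N. \<forall>n\<ge>N. p (\<sigma> m - \<sigma> n) < e" if "0 < e" for e
    proof -
      have "0 < 2 * min 1 e" using that by simp
      then obtain N where N: "\<And>m n. m \<ge> N \<Longrightarrow> n \<ge> N \<Longrightarrow> d (\<sigma> m) (\<sigma> n) < 2 * min 1 e"
        using \<open>MCauchy \<sigma>\<close> unfolding MCauchy_def by meson
      have "p (\<sigma> m - \<sigma> n) < e" if "m \<ge> N" "n \<ge> N" for m n
        using N[OF that] by (simp add: d_eq \<sigma> min_def split: if_splits)
      then show ?thesis by blast
    qed
    from complete[OF \<sigma> this] obtain l where l: "l \<in> X" "(\<lambda>n. p (\<sigma> n - l)) \<longlonglongrightarrow> 0"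
      by blast
    have "(\<lambda>n. 2 * min 1 (p (\<sigma> n - l))) \<longlonglongrightarrow> 2 * min 1 0"
      by (intro tendsto_intros l)
    then have "limitin mtopology \<sigma> l sequentially"
      using l by (simp add: limitin_metric_dist_null d_eq \<sigma>)
    then show "\<exists>x. limitin mtopology \<sigma> x sequentially" by blast
  qed
  then show "frechet_space smul X mtopology"
    unfolding frechet_space_def using vs sub p sep unfolding d_def
    by (intro conjI exI[of _ "\<lambda>_. p"]) auto
qed

definition c0 :: "(nat \<Rightarrow> 'k::real_normed_field) set" where
  "c0 = {x. x \<longlonglongrightarrow> 0}"

definition sup_norm :: "(nat \<Rightarrow> 'k::real_normed_field) \<Rightarrow> real" where
  "sup_norm x = (SUP i. norm (x i))"

lemma norm_le_sup_norm: "x \<in> c0 \<Longrightarrow> norm (x i) \<le> sup_norm x"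
proof -
  assume "x \<in> c0"
  then have "Bseq x" unfolding c0_def by (auto intro: convergent_imp_Bseq convergentI)
  then have "bdd_above (range (\<lambda>i. norm (x i)))" by (auto simp: Bseq_def bdd_above_def)
  then show ?thesis unfolding sup_norm_def by (intro cSUP_upper) auto
qed

lemma sup_norm_le: "(\<And>i. norm (x i) \<le> b) \<Longrightarrow> sup_norm x \<le> b"
  unfolding sup_norm_def by (intro cSUP_least) auto

lemma subspace_c0: "module.subspace seq_smul (c0 :: (nat \<Rightarrow> 'k::real_normed_field) set)"
proof -
  interpret vector_space "seq_smul :: 'k \<Rightarrow> _" by (rule vector_space_seq_smul)
  show ?thesis
    by (auto simp: subspace_def c0_def seq_smul_def plus_fun_def zero_fun_def
        intro!: tendsto_add_zero tendsto_mult_right_zero)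
qed

lemma c0_diff: "x \<in> c0 \<Longrightarrow> y \<in> c0 \<Longrightarrow> x - y \<in> c0"
  by (auto simp: c0_def fun_diff_def intro: tendsto_diff[of _ 0 _ _ 0, simplified])

lemma seminorm_sup_norm: "seminorm_on seq_smul c0 (sup_norm :: (nat \<Rightarrow> 'k::real_normed_field) \<Rightarrow> real)"
  unfolding seminorm_on_def
proof (intro conjI ballI allI)
  fix x y :: "nat \<Rightarrow> 'k" and c :: 'k
  assume x: "x \<in> c0"
  show nonneg: "0 \<le> sup_norm x" using norm_le_sup_norm[OF x, of 0] norm_ge_zero order_trans by blast
  have cx: "seq_smul c x \<in> c0"
    using x by (auto simp: c0_def seq_smul_def intro: tendsto_mult_right_zero)
  show "sup_norm (seq_smul c x) = norm c * sup_norm x"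
  proof (rule antisym)
    show "sup_norm (seq_smul c x) \<le> norm c * sup_norm x"
      by (intro sup_norm_le) (simp add: seq_smul_def norm_mult mult_left_mono norm_le_sup_norm x)
    show "norm c * sup_norm x \<le> sup_norm (seq_smul c x)"
    proof (cases "c = 0")
      case True
      then show ?thesis
        using norm_le_sup_norm[OF cx, of 0] by (simp add: order_trans[OF norm_ge_zero])
    next
      case False
      have "norm (x i) \<le> sup_norm (seq_smul c x) / norm c" for i
        using norm_le_sup_norm[OF cx, of i] False by (simp add: seq_smul_def norm_mult field_simps)
      then have "sup_norm x \<le> sup_norm (seq_smul c x) / norm c" by (rule sup_norm_le)
      then show ?thesis using False by (simp add: field_simps)
    qed
  qed
  assume y: "y \<in> c0"
  show "sup_norm (x + y) \<le> sup_norm x + sup_norm y"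
    by (intro sup_norm_le)
      (auto simp: plus_fun_def intro!: norm_triangle_le add_mono norm_le_sup_norm x y)
qed

text \<open>The coordinatewise limit exists by completeness of the field.\<close>

lemma sup_norm_complete:
  fixes \<sigma> :: "nat \<Rightarrow> nat \<Rightarrow> 'k::real_normed_field"
  assumes \<sigma>: "\<And>n. \<sigma> n \<in> c0"
    and cauchy: "\<And>e. 0 < e \<Longrightarrow> \<exists>N. \<forall>m\<ge>N. \<forall>n\<ge>N. sup_norm (\<sigma> m - \<sigma> n) < e"
  shows "\<exists>l\<in>c0. (\<lambda>n. sup_norm (\<sigma> n - l)) \<longlonglongrightarrow> 0"
proof -
  have coord: "norm (\<sigma> m i - \<sigma> n i) \<le> sup_norm (\<sigma> m - \<sigma> n)" for m n i
    using norm_le_sup_norm[OF c0_diff[OF \<sigma> \<sigma>], of m n i] by simp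
  have "Cauchy (\<lambda>n. \<sigma> n i)" for i
    unfolding Cauchy_def dist_norm using cauchy coord by (meson order_le_less_trans)
  then have "convergent (\<lambda>n. \<sigma> n i)" for i by (rule real_normed_field_complete)
  then obtain l where l: "\<And>i. (\<lambda>n. \<sigma> n i) \<longlonglongrightarrow> l i" unfolding convergent_def by metis
  have close: "\<exists>N. \<forall>n\<ge>N. \<forall>i. norm (\<sigma> n i - l i) \<le> e" if "0 < e" for e
  proof -
    obtain N where N: "\<And>m n. m \<ge> N \<Longrightarrow> n \<ge> N \<Longrightarrow> sup_norm (\<sigma> m - \<sigma> n) < e"
      using cauchy[OF \<open>0 < e\<close>] by blast
    have "norm (\<sigma> n i - l i) \<le> e" if "n \<ge> N" for n i
    proof (rule Lim_bounded)
      show "(\<lambda>m. norm (\<sigma> n i - \<sigma> m i)) \<longlonglongrightarrow> norm (\<sigma> n i - l i)"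
        by (intro tendsto_intros l)
      show "\<forall>m\<ge>N. norm (\<sigma> n i - \<sigma> m i) \<le> e"
        using coord N[OF that] by (meson less_imp_le order_trans)
    qed
    then show ?thesis by blast
  qed
  have "l \<in> c0"
    unfolding c0_def mem_Collect_eq
  proof (rule LIMSEQ_I)
    fix e :: real assume "0 < e"
    then have "0 < e / 2" by simp
    from close[OF this] obtain n where n: "\<And>i. norm (\<sigma> n i - l i) \<le> e / 2" by blast
    obtain I where I: "\<And>i. i \<ge> I \<Longrightarrow> norm (\<sigma> n i) < e / 2"
      using LIMSEQ_D[OF _ \<open>0 < e / 2\<close>] \<sigma>[of n] by (force simp: c0_def)
    have "norm (l i - 0) < e" if "i \<ge> I" for i
      using n[of i] I[OF that] norm_triangle_ineq4[of "\<sigma> n i" "\<sigma> n i - l i"] by simp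
    then show "\<exists>I. \<forall>i\<ge>I. norm (l i - 0) < e" by blast
  qed
  moreover have "(\<lambda>n. sup_norm (\<sigma> n - l)) \<longlonglongrightarrow> 0"
  proof (rule LIMSEQ_I)
    fix e :: real assume "0 < e"
    then have "0 < e / 2" by simp
    from close[OF this] obtain N where N: "\<And>n i. n \<ge> N \<Longrightarrow> norm (\<sigma> n i - l i) \<le> e / 2" by blast
    have "norm (sup_norm (\<sigma> n - l) - 0) < e" if "n \<ge> N" for n
    proof -
      have "sup_norm (\<sigma> n - l) \<le> e / 2" using N[OF that] by (intro sup_norm_le) simp
      moreover have "0 \<le> sup_norm (\<sigma> n - l)"
        using seminorm_sup_norm c0_diff[OF \<sigma> \<open>l \<in> c0\<close>] by (auto simp: seminorm_on_def)
      ultimately show ?thesis using \<open>0 < e\<close> by simp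
    qed
    then show "\<exists>N. \<forall>n\<ge>N. norm (sup_norm (\<sigma> n - l) - 0) < e" by blast
  qed
  ultimately show ?thesis by blast
qed

lemma sup_norm_eq_0: "x \<in> c0 \<Longrightarrow> sup_norm x = 0 \<Longrightarrow> x = 0"
  using norm_le_sup_norm[of x] by (auto simp: fun_eq_iff zero_fun_def)


section \<open>Approximate visits along arithmetic progressions\<close>

text \<open>The block for \<open>m\<close> is the progression of length and difference \<open>r = 2\<^sup>m\<close> that starts at \<open>r\<^sup>2\<close>; it
  ends below \<open>2 * r\<^sup>2\<close>, well before the next block.  The element 0 guarantees that every index has a
  last time at or before it.\<close>

definition spread_times :: "nat set" where
  "spread_times = insert 0 {4 ^ m + j * 2 ^ m | m j. j < 2 ^ m}"

lemma spread_times_contains_AP: "j \<le> m \<Longrightarrow> 4 ^ m + j * 2 ^ m \<in> spread_times"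
  unfolding spread_times_def using le_less_trans[OF _ less_exp[of m]] by blast

text \<open>An element \<open>d\<close> of the block with difference \<open>r = 2\<^sup>m\<close> has square root at most \<open>3 / 2 * r\<close>, so
  \<open>(sqrt d + 1 / 4)\<^sup>2 = d + sqrt d / 2 + 1 / 16 \<le> d + r\<close>, and the next element is at least \<open>d + r\<close>.\<close>

lemma spread_times_sqrt_gap:
  assumes "d \<in> spread_times" "d' \<in> spread_times" "d < d'"
  shows "sqrt (real d) + 1 / 4 \<le> sqrt (real d')"
proof (cases "d = 0")
  case True
  have "1 \<le> sqrt (real d')" using assms by simp
  then have "1 / 4 \<le> sqrt (real d')" by linarith
  with True show ?thesis by simp
next
  case False
  then obtain m j where d: "d = 4 ^ m + j * 2 ^ m" "j < 2 ^ m"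
    using assms by (auto simp: spread_times_def)
  obtain m' j' where d': "d' = 4 ^ m' + j' * 2 ^ m'" "j' < 2 ^ m'"
    using assms by (auto simp: spread_times_def)
  have four: "(4::nat) ^ i = 2 ^ i * 2 ^ i" for i by (simp flip: power_mult_distrib)
  have upper: "4 ^ i + k * 2 ^ i < 2 * (4::nat) ^ i" if "k < 2 ^ i" for i k :: nat
    using that by (simp add: four)
  have "m \<le> m'"
  proof (rule ccontr)
    assume "\<not> m \<le> m'"
    then have "(4::nat) ^ Suc m' \<le> 4 ^ m" by (intro power_increasing) auto
    with upper[OF d'(2)] d d' assms(3) show False by simp
  qed
  have gap: "d + 2 ^ m \<le> d'"
  proof (cases "m = m'")
    case True
    with d d' assms(3) have "Suc j * 2 ^ m \<le> j' * 2 ^ m" by (intro mult_right_mono) auto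
    with True d d' show ?thesis by simp
  next
    case False
    with \<open>m \<le> m'\<close> have "(4::nat) ^ Suc m \<le> 4 ^ m'" by (intro power_increasing) auto
    moreover have "(2::nat) ^ m \<le> 4 ^ m" by (intro power_mono) auto
    ultimately show ?thesis using upper[OF d(2)] d d' by simp
  qed
  define r :: real where "r = 2 ^ m"
  have "real d \<le> (3 / 2 * r)\<^sup>2"
  proof -
    have "real d \<le> real (2 * 4 ^ m)" using upper[OF d(2)] d(1) by (simp only: of_nat_le_iff)
    also have "\<dots> = 2 * r\<^sup>2" by (simp add: r_def power2_eq_square flip: power_mult_distrib)
    also have "\<dots> \<le> (3 / 2 * r)\<^sup>2" by (simp add: power_mult_distrib power_divide)
    finally show ?thesis .
  qed
  then have sq: "sqrt (real d) \<le> 3 / 2 * r" by (rule real_le_lsqrt[rotated]) (simp add: r_def)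
  have "(sqrt (real d) + 1 / 4)\<^sup>2 = real d + sqrt (real d) / 2 + 1 / 16"
    by (simp add: power2_sum power_divide)
  also have "\<dots> \<le> real d + r"
  proof -
    have "1 \<le> r" by (simp add: r_def)
    with sq show ?thesis by linarith
  qed
  also have "\<dots> = real (d + 2 ^ m)" by (simp add: r_def)
  also have "\<dots> \<le> real d'" using gap by (simp only: of_nat_le_iff)
  finally show ?thesis by (rule real_le_rsqrt)
qed

text \<open>The vector \<open>x\<close> repeats the first \<open>N\<close> entries of \<open>u\<close>, scaled by \<open>1 / lam n\<close>, from each \<open>n \<in> D\<close> on; the
  gaps keep the copies apart.  It is a null sequence because the visit at time \<open>n\<close> itself bounds all
  later entries by \<open>(M + e) / lam n\<close>.\<close>

lemma approximate_visits:
  fixes u :: "nat \<Rightarrow> 'k::real_normed_field" and lam :: "nat \<Rightarrow> real"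
  assumes e: "0 < e"
    and tail: "\<And>i. N \<le> i \<Longrightarrow> norm (u i) \<le> e / 2"
    and M: "\<And>i. norm (u i) \<le> M"
    and lam: "\<And>n. 0 < lam n"
    and D0: "0 \<in> D"
    and gap: "\<And>n n'. n \<in> D \<Longrightarrow> n' \<in> D \<Longrightarrow> n < n' \<Longrightarrow> n + N \<le> n'"
    and growth: "\<And>n n'. n \<in> D \<Longrightarrow> n' \<in> D \<Longrightarrow> n < n' \<Longrightarrow> lam n * M \<le> e / 2 * lam n'"
    and unbounded: "\<And>B. \<exists>n\<in>D. B \<le> lam n"
  shows "\<exists>x\<in>c0. \<forall>n\<in>D. \<forall>i. norm (of_real (lam n) * x (i + n) - u i) \<le> e"
proof -
  define last where "last k = Max {n \<in> D. n \<le> k}" for k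
  have fin: "finite {n \<in> D. n \<le> k}" for k by simp
  have last_in: "last k \<in> D" "last k \<le> k" for k
  proof -
    have "{n \<in> D. n \<le> k} \<noteq> {}" using D0 by blast
    from Max_in[OF fin this] show "last k \<in> D" "last k \<le> k" by (auto simp: last_def)
  qed
  have last_ge: "n \<le> last k" if "n \<in> D" "n \<le> k" for n k
    unfolding last_def using that by (intro Max_ge fin) auto
  define x where "x k = (if k - last k < N then u (k - last k) / of_real (lam (last k)) else 0)" for k
  have M0: "0 \<le> M" using M[of 0] norm_ge_zero order_trans by blast
  have approx: "norm (of_real (lam n) * x (i + n) - u i) \<le> e" if n: "n \<in> D" for n i
  proof (cases "last (i + n) = n")
    case True
    \<comment> \<open>The coordinate belongs to the copy at \<open>n\<close>, or to the zeros following it.\<close>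
    then show ?thesis using lam[of n] e tail[of i] by (auto simp: x_def)
  next
    case False
    \<comment> \<open>The coordinate belongs to a later copy: both \<open>u i\<close> and the contribution of \<open>x\<close> are small.\<close>
    define n' where "n' = last (i + n)"
    have n': "n' \<in> D" "n < n'" "n' \<le> i + n"
      using last_in[of "i + n"] last_ge[OF n, of "i + n"] False by (auto simp: n'_def)
    then have "norm (u i) \<le> e / 2" using gap[OF n n'(1,2)] by (intro tail) simp
    moreover have "norm (x (i + n)) \<le> M / lam n'"
      unfolding x_def n'_def[symmetric] using M M0 lam[of n']
      by (auto simp: norm_divide intro: divide_right_mono)
    then have "lam n * norm (x (i + n)) \<le> lam n * (M / lam n')"
      using lam[of n] by (intro mult_left_mono) auto
    moreover have "lam n * (M / lam n') \<le> e / 2"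
      using growth[OF n n'(1,2)] lam[of n'] by (simp add: field_simps)
    moreover have "norm (of_real (lam n) * x (i + n)) = lam n * norm (x (i + n))"
      using lam[of n] by (simp add: norm_mult)
    ultimately show ?thesis
      using norm_triangle_ineq4[of "of_real (lam n) * x (i + n)" "u i"] by linarith
  qed
  have "x \<in> c0"
    unfolding c0_def mem_Collect_eq
  proof (rule LIMSEQ_I)
    fix \<eta> :: real assume \<eta>: "0 < \<eta>"
    obtain n where n: "n \<in> D" "(M + e + 1) / \<eta> \<le> lam n" using unbounded by blast
    have "norm (x k - 0) < \<eta>" if "n \<le> k" for k
    proof -
      define i where "i = k - n"
      then have k: "k = i + n" using that by simp
      have "lam n * norm (x k) = norm (of_real (lam n) * x k)"
        using lam[of n] by (simp add: norm_mult)
      also have "\<dots> \<le> M + e"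
        using approx[OF n(1), of i] M[of i] norm_triangle_sub[of "of_real (lam n) * x k" "u i"]
        by (simp add: k)
      also have "\<dots> < lam n * \<eta>" using n(2) \<eta> by (simp add: field_simps)
      finally show ?thesis using lam[of n] by simp
    qed
    then show "\<exists>n. \<forall>k\<ge>n. norm (x k - 0) < \<eta>" by blast
  qed
  with approx show ?thesis by blast
qed

text \<open>Dilating the times by \<open>R\<^sup>2\<close> multiplies the gaps of their square roots by \<open>R\<close>, so the scalars grow
  at least by the factor \<open>exp (R / 4) \<ge> 1 + R / 4\<close> from one time to the next.\<close>

lemma approximate_AP_visits:
  fixes u :: "nat \<Rightarrow> 'k::real_normed_field"
  assumes u: "u \<in> c0" and e: "0 < e"
  shows "\<exists>x\<in>c0. \<exists>D\<in>AP_family. \<forall>n\<in>D. \<forall>i.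
    norm (of_real (exp (sqrt (real n))) * x (i + n) - u i) \<le> e"
proof -
  obtain N where N: "\<And>i. N \<le> i \<Longrightarrow> norm (u i) \<le> e / 2"
    using LIMSEQ_D[of u 0 "e / 2"] u e by (force simp: c0_def)
  define M where "M = sup_norm u"
  obtain R0 :: nat where R0: "8 * M / e \<le> real R0" using real_arch_simple by blast
  define R where "R = R0 + N + 1"
  define D where "D = (\<lambda>d. R\<^sup>2 * d) ` spread_times"
  have R: "N \<le> R" "1 \<le> R" "8 * M / e \<le> real R" using R0 by (auto simp: R_def)
  have sqrt_scaled: "sqrt (real (R\<^sup>2 * d)) = real R * sqrt (real d)" for d
    by (simp add: real_sqrt_mult)
  have "\<exists>x\<in>c0. \<forall>n\<in>D. \<forall>i. norm (of_real (exp (sqrt (real n))) * x (i + n) - u i) \<le> e"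
  proof (rule approximate_visits[OF e N])
    show "norm (u i) \<le> M" for i unfolding M_def by (rule norm_le_sup_norm[OF u])
    show "0 \<in> D" by (auto simp: D_def spread_times_def)
    fix n n' assume "n \<in> D" "n' \<in> D" "n < n'"
    then obtain d d' where d: "d \<in> spread_times" "d' \<in> spread_times" "d < d'"
      and n: "n = R\<^sup>2 * d" "n' = R\<^sup>2 * d'"
      by (auto simp: D_def)
    have "R\<^sup>2 * Suc d \<le> n'" unfolding n using d(3) by (intro mult_left_mono) auto
    moreover have "N \<le> R\<^sup>2" using R self_le_power[of R 2] by simp
    ultimately show "n + N \<le> n'" by (simp add: n)
    have "M \<le> e / 2 * (1 + real R / 4)" using R(3) e by (simp add: field_simps)
    also have "\<dots> \<le> e / 2 * exp (real R / 4)" using e by (intro mult_left_mono exp_ge_add_one_self) auto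
    finally have "exp (sqrt (real n)) * M \<le> exp (sqrt (real n)) * (e / 2 * exp (real R / 4))"
      by (intro mult_left_mono) auto
    also have "\<dots> = e / 2 * exp (real R * (sqrt (real d) + 1 / 4))"
      unfolding n sqrt_scaled by (simp add: distrib_left exp_add)
    also have "\<dots> \<le> e / 2 * exp (sqrt (real n'))"
      unfolding n sqrt_scaled using e spread_times_sqrt_gap[OF d]
      by (intro mult_left_mono) (auto intro: mult_left_mono)
    finally show "exp (sqrt (real n)) * M \<le> e / 2 * exp (sqrt (real n'))" .
  next
    fix B :: real
    obtain m :: nat where m: "B \<le> real m" using real_arch_simple by blast
    have "sqrt (real (4 ^ m)) = 2 ^ m" by (simp add: real_sqrt_power)
    then have "real m \<le> sqrt (real (4 ^ m))" using less_exp[of m] by (simp flip: of_nat_less_iff)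
    also have "\<dots> \<le> real R * sqrt (real (4 ^ m))" using R(2) by (simp add: mult_le_cancel_right1)
    also have "\<dots> \<le> exp (sqrt (real (R\<^sup>2 * 4 ^ m)))"
      unfolding sqrt_scaled[symmetric] using exp_ge_add_one_self[of "sqrt (real (R\<^sup>2 * 4 ^ m))"] by linarith
    finally have "B \<le> exp (sqrt (real (R\<^sup>2 * 4 ^ m)))" using m by linarith
    moreover have "R\<^sup>2 * 4 ^ m \<in> D"
      using spread_times_contains_AP[of 0 m] by (auto simp: D_def)
    ultimately show "\<exists>n\<in>D. B \<le> exp (sqrt (real n))" by blast
  qed simp_all
  moreover have "D \<in> AP_family"
    unfolding AP_family_def mem_Collect_eq
  proof (intro allI exI conjI impI)
    fix m j
    show "1 \<le> R\<^sup>2 * 2 ^ m" using R(2) by simp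
    assume "j \<le> m"
    have "R\<^sup>2 * 4 ^ m + j * (R\<^sup>2 * 2 ^ m) = R\<^sup>2 * (4 ^ m + j * 2 ^ m)" by (simp add: algebra_simps)
    then show "R\<^sup>2 * 4 ^ m + j * (R\<^sup>2 * 2 ^ m) \<in> D"
      using spread_times_contains_AP[OF \<open>j \<le> m\<close>] by (auto simp: D_def)
  qed
  ultimately show ?thesis by blast
qed

section \<open>The backward shift\<close>

theorem corollary5p7:
  "\<exists>(X :: (nat \<Rightarrow> 'k::real_normed_field) set) \<tau> T (lam :: nat \<Rightarrow> 'k).
     frechet_space seq_smul X \<tau> \<and>
     linear_operator_on seq_smul X T \<and> continuous_map \<tau> \<tau> T \<and>
     (\<forall>n. lam n \<noteq> 0) \<and>
     (\<lambda>n. lam (Suc n) / lam n) \<longlonglongrightarrow> 1 \<and>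
     has_property_P AP_family \<tau> (\<lambda>n x. seq_smul (lam n) ((T ^^ n) x)) \<and>
     \<not> multiply_recurrent \<tau> T"
proof -
  define d where "d = frechet_dist (c0 :: (nat \<Rightarrow> 'k) set) (\<lambda>_. sup_norm)"
  have banach: "Metric_space c0 d"
    "frechet_space seq_smul (c0 :: (nat \<Rightarrow> 'k) set) (Metric_space.mtopology c0 d)"
    "\<And>x y. x \<in> c0 \<Longrightarrow> y \<in> c0 \<Longrightarrow> d x y = 2 * min 1 (sup_norm (x - y))"
    unfolding d_def
    by (rule frechet_space_if_complete_norm[OF vector_space_seq_smul subspace_c0
          seminorm_sup_norm sup_norm_eq_0 sup_norm_complete]; blast)+
  interpret Metric_space c0 d by (rule banach(1))
  \<comment> \<open>The factor 2 in the distance halves radii; for \<open>r \<le> 2\<close> the truncation at 1 is not felt.\<close>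
  have d_small: "d x y < r" if "x \<in> c0" "y \<in> c0" "sup_norm (x - y) < r / 2" for x y r
    using banach(3)[OF that(1,2)] that(3) by simp
  have d_coord: "norm (x i - y i) < r / 2" if "x \<in> c0" "y \<in> c0" "d x y < r" "r \<le> 2" for x y r i
    using banach(3)[OF that(1,2)] that(3,4) norm_le_sup_norm[OF c0_diff[OF that(1,2)], of i]
    by (auto simp: min_def split: if_splits)
  define B :: "(nat \<Rightarrow> 'k) \<Rightarrow> nat \<Rightarrow> 'k" where "B x = (\<lambda>i. x (Suc i))" for x
  have Bn: "(B ^^ n) x = (\<lambda>i. x (i + n))" for n x
    by (induction n) (auto simp: B_def)
  have B_c0: "B x \<in> c0" if "x \<in> c0" for x
    using that by (simp add: c0_def B_def LIMSEQ_Suc)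
  have Bn_c0: "(B ^^ n) x \<in> c0" if "x \<in> c0" for x n
    using that by (induction n) (auto intro: B_c0)
  define lam :: "nat \<Rightarrow> 'k" where "lam n = of_real (exp (sqrt (real n)))" for n
  have lam_c0: "seq_smul (lam n) x \<in> c0" if "x \<in> c0" for n x
    using that by (auto simp: c0_def seq_smul_def intro: tendsto_mult_right_zero)
  have "linear_operator_on seq_smul c0 B"
    unfolding linear_operator_on_def using B_c0 by (auto simp: B_def seq_smul_def plus_fun_def)
  moreover have "continuous_map mtopology mtopology B"
  proof -
    have "openin mtopology {x \<in> c0. B x \<in> V}" if V: "openin mtopology V" for V
      unfolding openin_mtopology
    proof (intro conjI allI impI)
      fix x assume x: "x \<in> {x \<in> c0. B x \<in> V}"
      then obtain r where r: "0 < r" "mball (B x) r \<subseteq> V" using V by (auto simp: openin_mtopology)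
      have "B y \<in> V" if y: "y \<in> c0" "d x y < r" for y
      proof -
        have "d (B x) (B y) \<le> d x y"
        proof -
          have "sup_norm (B x - B y) \<le> sup_norm (x - y)"
            using norm_le_sup_norm[OF c0_diff, of x y] x y
            by (intro sup_norm_le) (auto simp: B_def)
          then show ?thesis using x y B_c0 by (simp add: banach(3))
        qed
        then have "B y \<in> mball (B x) r" using x y B_c0 by (simp add: in_mball)
        then show ?thesis using r by blast
      qed
      then show "\<exists>r>0. mball x r \<subseteq> {x \<in> c0. B x \<in> V}"
        using r(1) by (intro exI[of _ r]) auto
    qed simp
    then show ?thesis using B_c0 by (auto simp: continuous_map_def)
  qed
  moreover have "\<forall>n. lam n \<noteq> 0" by (simp add: lam_def)
  moreover have "(\<lambda>n. lam (Suc n) / lam n) \<longlonglongrightarrow> 1"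
  proof -
    have "(\<lambda>n. exp (sqrt (real (Suc n))) / exp (sqrt (real n))) \<longlonglongrightarrow> 1" by real_asymp
    from tendsto_of_real[OF this, where 'a = 'k] show ?thesis by (simp add: lam_def)
  qed
  moreover have "has_property_P AP_family mtopology (\<lambda>n x. seq_smul (lam n) ((B ^^ n) x))"
    unfolding has_property_P_def
  proof (intro allI impI)
    fix U assume U: "openin mtopology U \<and> U \<noteq> {}"
    then obtain u r where u: "u \<in> c0" "0 < r" "mball u r \<subseteq> U"
      unfolding openin_mtopology by blast
    obtain x A where x: "x \<in> c0" "A \<in> AP_family"
      "\<And>n i. n \<in> A \<Longrightarrow> norm (lam n * x (i + n) - u i) \<le> r / 4"
      using approximate_AP_visits[OF u(1), of "r / 4"] u(2) unfolding lam_def by auto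
    have "seq_smul (lam n) ((B ^^ n) x) \<in> U" if n: "n \<in> A" for n
    proof -
      define y where "y = seq_smul (lam n) ((B ^^ n) x)"
      have y: "y \<in> c0" unfolding y_def by (intro lam_c0 Bn_c0 x)
      have "sup_norm (u - y) \<le> r / 4"
        using x(3)[OF n] by (intro sup_norm_le) (simp add: y_def Bn seq_smul_def norm_minus_commute)
      then have "y \<in> mball u r" using u y by (auto simp: in_mball intro: d_small)
      then show ?thesis using u(3) by (auto simp: y_def)
    qed
    then have "A \<subseteq> {n. seq_smul (lam n) ((B ^^ n) x) \<in> U}" by blast
    with x(2) have "{n. seq_smul (lam n) ((B ^^ n) x) \<in> U} \<in> AP_family"
      unfolding AP_family_def by blast
    with x(1) show "\<exists>x\<in>topspace mtopology. {n. seq_smul (lam n) ((B ^^ n) x) \<in> U} \<in> AP_family"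
      by auto
  qed
  moreover have "\<not> multiply_recurrent mtopology B"
  proof
    assume rec: "multiply_recurrent mtopology B"
    define e0 :: "nat \<Rightarrow> 'k" where "e0 i = (if i = 0 then 1 else 0)" for i
    have e0: "e0 \<in> c0"
      unfolding c0_def mem_Collect_eq by (rule LIMSEQ_I) (auto simp: e0_def intro!: exI[of _ 1])
    have "openin mtopology (mball e0 1) \<and> mball e0 1 \<noteq> {}" using e0 by (auto simp: mball_eq_empty)
    with rec have "\<exists>k\<ge>1. (\<Inter>j\<in>{0..1}. {x \<in> topspace mtopology. (B ^^ (j * k)) x \<in> mball e0 1}) \<noteq> {}"
      unfolding multiply_recurrent_def by blast
    then obtain k x where k: "1 \<le> k"
      and x: "x \<in> (\<Inter>j\<in>{0..1}. {x \<in> topspace mtopology. (B ^^ (j * k)) x \<in> mball e0 1})"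
      by blast
    have "(B ^^ (0 * k)) x \<in> mball e0 1" "(B ^^ (1 * k)) x \<in> mball e0 1"
      using INT_D[OF x, of 0] INT_D[OF x, of 1] by auto
    then have "norm (e0 k - x k) < 1 / 2" "norm (e0 0 - (B ^^ k) x 0) < 1 / 2"
      using d_coord[of e0 x 1 k] d_coord[of e0 "(B ^^ k) x" 1 0] by (auto simp: in_mball)
    then have "norm (x k) < 1 / 2" "norm (1 - x k) < 1 / 2"
      using k by (auto simp: e0_def Bn)
    then show False using norm_triangle_ineq[of "1 - x k" "x k"] by simp
  qed
  ultimately show ?thesis using banach(2) by blast
qed

end
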